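(* Let $q$ be a prime power with $q\equiv 1 \pmod 4$ and $q>9$, let $K=\mathbb{F}_q$, and let $\eta$ be the quadratic character of $K$. Fix $e,f\in K$ with $e^4=1$ and $f^2=-1$. Let $H=K\times K$ (the additive group), $N=\{0\}\times K\le H$, and let $G$ be the group $$G=\langle x,H \mid x^4=1,\ x^{-1}(u,v)x=(eu,fv)\ \ \forall (u,v)\in H\rangle$$ (the semidirect product of $H$ by a cyclic group $\langle x\rangle$ of order $4$), of order $4q^2$. Choose $s_2\in K^*$ such that, with $$s_1=\tfrac12\Big((1+s_2)+\tfrac{f}{e^2}(1-s_2)\Big),\qquad s_3=\tfrac12\Big((1+s_2)-\tfrac{f}{e^2}(1-s_2)\Big),$$ one has $\eta(s_1s_2s_3)=-1$ (such $s_2$ exists). Define $R_0=\{(y,y^2): y\in K\}$, $R_1=\{(y,s_1^{-1}y^2): y\in K\}$, $R_2=\{(y,s_2^{-1}y^2): y\in K\}$, $R_3=\{(y,s_3^{-1}y^2): y\in K\}$, and $$R=R_0\cup R_1x\cup R_2x^2\cup R_3x^3\subseteq G.$$ Then $R$ is a $(4q,q,4q,4)$ relative difference set in $G$ relative to $N$.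
   Context: The quadratic character $\eta$ on $K=\mathbb{F}_q$ ($q$ odd) is $\eta(x)=1$ if $x$ is a nonzero square, $\eta(0)=0$, and $\eta(x)=-1$ if $x$ is a nonsquare. Let $G$ be a finite multiplicative group of order $mn$ and $N$ a subgroup of order $n$. A $k$-subset $R$ of $G$ is an $(m,n,k,\lambda)$ relative difference set in $G$ relative to $N$ if every element $g\in G\setminus N$ has exactly $\lambda$ representations $g=r_1r_2^{-1}$ with $r_1,r_2\in R$, and no non-identity element of $N$ has such a representation. *)

theory Defs
  imports
    "HOL-Algebra.Coset"
    "HOL-Number_Theory.Cong"
    "HOL-Number_Theory.Prime_Powers"
    "HOL-Library.Cardinality"
    "HOL-Library.Product_Plus"
begin

definition quadratic_character :: "'a::field \<Rightarrow> int" where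
  "quadratic_character x =
     (if x = 0 then 0 else if \<exists>y. x = y\<^sup>2 then 1 else - 1)"

definition relative_difference_set ::
    "('g, 'b) monoid_scheme \<Rightarrow> 'g set \<Rightarrow> nat \<Rightarrow> nat \<Rightarrow> nat \<Rightarrow> nat \<Rightarrow> 'g set \<Rightarrow> bool" where
  "relative_difference_set G N m n k l R \<longleftrightarrow>
     group G \<and> finite (carrier G) \<and> order G = m * n \<and>
     subgroup N G \<and> card N = n \<and>
     R \<subseteq> carrier G \<and> card R = k \<and>
     (\<forall>g \<in> carrier G - N.
        card {(r1, r2). r1 \<in> R \<and> r2 \<in> R \<and> g = r1 \<otimes>\<^bsub>G\<^esub> inv\<^bsub>G\<^esub> r2} = l) \<and>
     (\<forall>g \<in> N - {\<one>\<^bsub>G\<^esub>}. \<not> (\<exists>r1 \<in> R. \<exists>r2 \<in> R. g = r1 \<otimes>\<^bsub>G\<^esub> inv\<^bsub>G\<^esub> r2))"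

text \<open>
  The pair \<open>((u, v), i)\<close> stands for the product of \<open>(u, v) \<in> H\<close> with the \<open>i\<close>-th power of \<open>x\<close>,
  in this order. The relation \<open>x\<inverse> (u, v) x = (e u, f v)\<close> says that moving \<open>x\<close> from the left
  to the right of an element of \<open>H\<close> multiplies its coordinates by \<open>e\<inverse>\<close> and \<open>f\<inverse>\<close>; this is
  where the inverses in the multiplication come from. That this is the group with the given
  presentation is shown in \<open>semidirect_relations\<close>, \<open>semidirect_normal_form\<close> and
  \<open>semidirect_universal\<close>.
\<close>

definition semidirect :: "'a::field \<Rightarrow> 'a \<Rightarrow> (('a \<times> 'a) \<times> nat) monoid" where
  "semidirect e f =
     \<lparr>carrier = UNIV \<times> {0..<4},
      monoid.mult = (\<lambda>((u, v), i) ((u', v'), j).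
        ((u + inverse e ^ i * u', v + inverse f ^ i * v'), (i + j) mod 4)),
      monoid.one = ((0, 0), 0)\<rparr>"

definition embH :: "'a \<times> 'a \<Rightarrow> ('a \<times> 'a) \<times> nat" where
  "embH h = (h, 0)"

definition genx :: "('a::zero \<times> 'a) \<times> nat" where
  "genx = ((0, 0), 1)"

definition subN :: "(('a::zero \<times> 'a) \<times> nat) set" where
  "subN = embH ` ({0} \<times> UNIV)"

definition s1 :: "'a::field \<Rightarrow> 'a \<Rightarrow> 'a \<Rightarrow> 'a" where
  "s1 e f s2 = 1 / 2 * ((1 + s2) + f / e\<^sup>2 * (1 - s2))"

definition s3 :: "'a::field \<Rightarrow> 'a \<Rightarrow> 'a \<Rightarrow> 'a" where
  "s3 e f s2 = 1 / 2 * ((1 + s2) - f / e\<^sup>2 * (1 - s2))"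

definition parabola :: "'a::field \<Rightarrow> ('a \<times> 'a) set" where
  "parabola s = {(y, inverse s * y\<^sup>2) | y. True}"

definition setR :: "'a::field \<Rightarrow> 'a \<Rightarrow> 'a \<Rightarrow> (('a \<times> 'a) \<times> nat) set" where
  "setR e f s2 =
     embH ` {(y, y\<^sup>2) | y. True}
     \<union> (embH ` parabola (s1 e f s2) #>\<^bsub>semidirect e f\<^esub> genx)
     \<union> (embH ` parabola s2 #>\<^bsub>semidirect e f\<^esub> (genx [^]\<^bsub>semidirect e f\<^esub> (2::nat)))
     \<union> (embH ` parabola (s3 e f s2) #>\<^bsub>semidirect e f\<^esub> (genx [^]\<^bsub>semidirect e f\<^esub> (3::nat)))"

lemma power_mod_4:
  fixes a :: "'a::field"
  assumes "a ^ 4 = 1"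
  shows "a ^ (i mod 4) = a ^ i"
proof -
  have "a ^ i = a ^ (4 * (i div 4) + i mod 4)" by simp
  also have "\<dots> = a ^ (i mod 4)"
    by (simp only: power_add power_mult assms power_one mult_1_left)
  finally show ?thesis by simp
qed

lemma semidirect_group:
  fixes e f :: "'a::field"
  assumes e: "e ^ 4 = 1" and f: "f\<^sup>2 = - 1"
  shows "group (semidirect e f)"
proof (rule groupI)
  have f4: "f ^ 4 = 1"
    using f by (metis (no_types) mult_2 numeral_Bit0 one_power2 power2_minus power_even_eq power_mult)
  have ie: "inverse e ^ 4 = 1" and jf: "inverse f ^ 4 = 1"
    using e f4 by (simp_all add: power_inverse)
  note pe = power_mod_4[OF ie] and pf = power_mod_4[OF jf]
  let ?G = "semidirect e f"
  show "a \<otimes>\<^bsub>?G\<^esub> b \<in> carrier ?G" if "a \<in> carrier ?G" "b \<in> carrier ?G" for a b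
    using that by (auto simp: semidirect_def)
  show "\<one>\<^bsub>?G\<^esub> \<in> carrier ?G" by (simp add: semidirect_def)
  show "a \<otimes>\<^bsub>?G\<^esub> b \<otimes>\<^bsub>?G\<^esub> c = a \<otimes>\<^bsub>?G\<^esub> (b \<otimes>\<^bsub>?G\<^esub> c)" for a b c
    by (cases a; cases b; cases c)
       (auto simp: semidirect_def pe pf power_add algebra_simps mod_simps simp del: power_inverse)
  show "\<one>\<^bsub>?G\<^esub> \<otimes>\<^bsub>?G\<^esub> a = a" if "a \<in> carrier ?G" for a
    using that by (auto simp: semidirect_def)
  show "\<exists>b\<in>carrier ?G. b \<otimes>\<^bsub>?G\<^esub> a = \<one>\<^bsub>?G\<^esub>" if a: "a \<in> carrier ?G" for a
  proof -
    obtain u v i where [simp]: "a = ((u, v), i)" and i: "i < 4"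
      using a by (auto simp: semidirect_def)
    let ?j = "(4 - i) mod 4"
    have "(?j + i) mod 4 = 0" using i by (simp add: mod_simps)
    then show ?thesis
      by (intro bexI[of _ "((- (inverse e ^ ?j * u), - (inverse f ^ ?j * v)), ?j)"])
         (auto simp: semidirect_def)
  qed
qed

lemma semidirect_order:
  "order (semidirect (e::'a::{field,finite}) f) = 4 * CARD('a)\<^sup>2"
  by (simp add: order_def semidirect_def card_cartesian_product power2_eq_square
      flip: UNIV_Times_UNIV)

lemma genx_pow:
  "i < 4 \<Longrightarrow> genx [^]\<^bsub>semidirect e f\<^esub> (i::nat) = ((0, 0), i)"
  by (induction i) (auto simp: semidirect_def genx_def nat_pow_def)

lemma semidirect_relations:
  fixes e f :: "'a::field"
  assumes e: "e ^ 4 = 1" and f: "f\<^sup>2 = - 1"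
  shows "embH (h + h') = embH h \<otimes>\<^bsub>semidirect e f\<^esub> embH h'"
    and "genx [^]\<^bsub>semidirect e f\<^esub> (4::nat) = \<one>\<^bsub>semidirect e f\<^esub>"
    and "inv\<^bsub>semidirect e f\<^esub> genx \<otimes>\<^bsub>semidirect e f\<^esub> embH (u, v) \<otimes>\<^bsub>semidirect e f\<^esub> genx
           = embH (e * u, f * v)"
proof -
  interpret group "semidirect e f" by (rule semidirect_group[OF assms])
  have nz: "e \<noteq> 0" "f \<noteq> 0" using e f by auto
  have x: "genx \<in> carrier (semidirect e f)" and c: "embH k \<in> carrier (semidirect e f)" for k
    by (simp_all add: semidirect_def genx_def embH_def)
  show "embH (h + h') = embH h \<otimes>\<^bsub>semidirect e f\<^esub> embH h'"
    by (cases h; cases h') (simp add: semidirect_def embH_def)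
  have "genx [^]\<^bsub>semidirect e f\<^esub> (Suc 3) = \<one>\<^bsub>semidirect e f\<^esub>"
    unfolding nat_pow_Suc by (simp add: genx_pow) (simp add: semidirect_def genx_def)
  then show "genx [^]\<^bsub>semidirect e f\<^esub> (4::nat) = \<one>\<^bsub>semidirect e f\<^esub>" by simp
  have "embH (u, v) \<otimes>\<^bsub>semidirect e f\<^esub> genx = genx \<otimes>\<^bsub>semidirect e f\<^esub> embH (e * u, f * v)"
    using nz by (simp add: semidirect_def genx_def embH_def)
  then show "inv\<^bsub>semidirect e f\<^esub> genx \<otimes>\<^bsub>semidirect e f\<^esub> embH (u, v) \<otimes>\<^bsub>semidirect e f\<^esub> genx
           = embH (e * u, f * v)"
    using x c by (metis m_assoc inv_closed l_inv l_one)
qed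

lemma semidirect_normal_form:
  assumes "i < 4"
  shows "(h, i) = embH h \<otimes>\<^bsub>semidirect e f\<^esub> genx [^]\<^bsub>semidirect e f\<^esub> (i::nat)"
  using assms by (cases h) (simp add: genx_pow, simp add: semidirect_def embH_def)

lemma semidirect_universal:
  fixes e f :: "'a::field" and L (structure)
  assumes e: "e ^ 4 = 1" and f: "f\<^sup>2 = - 1"
    and L: "group L"
    and \<theta>: "\<And>h. \<theta> h \<in> carrier L" "\<And>h h'. \<theta> (h + h') = \<theta> h \<otimes> \<theta> h'"
    and y: "y \<in> carrier L" "y [^] (4::nat) = \<one>"
    and rel: "\<And>u v. inv y \<otimes> \<theta> (u, v) \<otimes> y = \<theta> (e * u, f * v)"
  shows "\<exists>\<psi> \<in> hom (semidirect e f) L. (\<forall>h. \<psi> (embH h) = \<theta> h) \<and> \<psi> genx = y"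
proof -
  interpret group L by (rule L)
  have nz: "e \<noteq> 0" "f \<noteq> 0" using e f by auto
  have step: "y \<otimes> \<theta> (u, v) = \<theta> (inverse e * u, inverse f * v) \<otimes> y" for u v
  proof -
    have "e * (inverse e * u) = u" "f * (inverse f * v) = v"
      using nz by (simp_all flip: mult.assoc)
    then have "inv y \<otimes> \<theta> (inverse e * u, inverse f * v) \<otimes> y = \<theta> (u, v)"
      using rel[of "inverse e * u" "inverse f * v"] by (simp only:)
    then have "inv y \<otimes> (\<theta> (inverse e * u, inverse f * v) \<otimes> y) = \<theta> (u, v)"
      using \<theta> y by (simp add: m_assoc)
    then show ?thesis
      using \<theta> y by (metis inv_solve_left m_closed)
  qed
  have steps: "y [^] (i::nat) \<otimes> \<theta> (u, v) = \<theta> (inverse e ^ i * u, inverse f ^ i * v) \<otimes> y [^] i"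
    for i u v
  proof (induction i arbitrary: u v)
    case 0
    then show ?case using \<theta> by simp
  next
    case (Suc i)
    have "y [^] Suc i \<otimes> \<theta> (u, v) = y [^] i \<otimes> (y \<otimes> \<theta> (u, v))"
      using \<theta> y by (simp add: m_assoc)
    also have "\<dots> = (y [^] i \<otimes> \<theta> (inverse e * u, inverse f * v)) \<otimes> y"
      using \<theta> y by (simp only: step) (simp add: m_assoc)
    also have "\<dots> = \<theta> (inverse e ^ Suc i * u, inverse f ^ Suc i * v) \<otimes> y [^] Suc i"
      using \<theta> y by (simp only: Suc) (simp add: m_assoc mult.assoc power_Suc2 del: power_Suc)
    finally show ?case .
  qed
  have ymod: "y [^] (i mod 4) = y [^] i" for i :: nat
  proof -
    have "y [^] i = y [^] (4 * (i div 4) + i mod 4)" by simp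
    also have "\<dots> = (y [^] (4::nat)) [^] (i div 4) \<otimes> y [^] (i mod 4)"
      using y(1) by (simp only: nat_pow_mult nat_pow_pow)
    also have "\<dots> = y [^] (i mod 4)" using y by simp
    finally show ?thesis by simp
  qed
  have \<theta>0: "\<theta> (0, 0) = \<one>"
    using \<theta>(2)[of "(0, 0)" "(0, 0)"] \<theta>(1) by simp
  define \<psi> where "\<psi> = (\<lambda>(h, i::nat). \<theta> h \<otimes> y [^] i)"
  have "\<psi> \<in> hom (semidirect e f) L"
  proof (rule homI)
    fix a b :: "('a \<times> 'a) \<times> nat"
    show "\<psi> a \<in> carrier L" using \<theta> y by (cases a) (simp add: \<psi>_def)
    obtain u v i u' v' j where [simp]: "a = ((u, v), i)" "b = ((u', v'), j)"
      by (metis prod.exhaust)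
    let ?w = "(inverse e ^ i * u', inverse f ^ i * v')"
    have "\<psi> (a \<otimes>\<^bsub>semidirect e f\<^esub> b) = \<theta> ((u, v) + ?w) \<otimes> y [^] (i + j)"
      by (simp add: \<psi>_def semidirect_def ymod)
    also have "\<dots> = \<theta> (u, v) \<otimes> (\<theta> ?w \<otimes> y [^] i) \<otimes> y [^] j"
      using \<theta>(1) y by (simp only: \<theta>(2)) (simp add: m_assoc nat_pow_mult)
    also have "\<dots> = \<theta> (u, v) \<otimes> (y [^] i \<otimes> \<theta> (u', v')) \<otimes> y [^] j"
      by (simp only: steps)
    also have "\<dots> = \<psi> a \<otimes> \<psi> b"
      using \<theta>(1) y by (simp add: \<psi>_def m_assoc)
    finally show "\<psi> (a \<otimes>\<^bsub>semidirect e f\<^esub> b) = \<psi> a \<otimes> \<psi> b" .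
  qed
  moreover have "\<psi> (embH h) = \<theta> h" for h
    using \<theta> by (simp add: \<psi>_def embH_def)
  moreover have "\<psi> genx = y"
    using y by (simp add: \<psi>_def genx_def \<theta>0)
  ultimately show ?thesis by blast
qed

end

theory Submission
  imports Defs "HOL-Number_Theory.Residues"
begin

text \<open>
  Write \<open>s\<^sub>0 = 1\<close> and let \<open>g = (u, v) x\<^sup>k\<close>. Since \<open>g = r r'\<inverse>\<close> means \<open>g r' = r\<close>, the representations
  of \<open>g\<close> with \<open>r' \<in> R\<^sub>j x\<^sup>j\<close> correspond to the roots of a polynomial of degree at most two. For \<open>k = 0\<close>
  it is linear. For \<open>k \<noteq> 0\<close> the choice of \<open>s\<^sub>1\<close> and \<open>s\<^sub>3\<close> makes its leading coefficient
  \<open>e\<^bsup>-2k\<^esup> s\<^sub>j - f\<^bsup>-k\<^esup> s\<^sub>j\<^sub>+\<^sub>k\<close> nonzero and independent of \<open>j\<close>, so that its discriminant is a square times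
  \<open>s\<^sub>j s\<^sub>j\<^sub>+\<^sub>k D\<close> with \<open>D\<close> independent of \<open>j\<close>; hence \<open>g\<close> has \<open>4 + \<eta>(D) \<Sum>\<^sub>j \<eta>(s\<^sub>j s\<^sub>j\<^sub>+\<^sub>k)\<close> representations, and
  \<open>\<eta>(s\<^sub>1 s\<^sub>2 s\<^sub>3) = -1\<close> makes the sum vanish.

  As \<open>s\<^sub>1 s\<^sub>2 s\<^sub>3 = s\<^sub>2 (s\<^sub>2\<^sup>2 + 1) / 2\<close>, a suitable \<open>s\<^sub>2\<close> exists unless \<open>S(1)\<^sup>2 \<ge> (q - 3)\<^sup>2\<close>, where
  \<open>S(a) = \<Sum>\<^sub>s \<eta>(s (s\<^sup>2 + a))\<close>. The sum of \<open>S(a)\<^sup>2\<close> over all \<open>a\<close> is \<open>2 q (q - 1)\<close>, and \<open>S(a)\<^sup>2 = S(1)\<^sup>2\<close> for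
  the \<open>(q - 1) / 2\<close> nonzero squares \<open>a\<close>; therefore \<open>S(1)\<^sup>2 \<le> 4 q < (q - 3)\<^sup>2\<close> when \<open>q > 9\<close>.
\<close>

section \<open>The quadratic character of a finite field\<close>

lemma two_neq_zero_of_card:
  assumes "[CARD('a::{field,finite}) = 1] (mod 4)"
  shows "(2::'a) \<noteq> 0"
proof
  assume "(2::'a) = 0"
  then have "of_nat 2 = (0::'a)" by simp
  then have "CHAR('a) dvd 2" by (simp only: of_nat_eq_0_iff_char_dvd)
  then have "CHAR('a) = 2"
    using CHAR_not_1'[where 'a = 'a] by (metis prime_nat_iff two_is_prime_nat One_nat_def)
  then have "2 dvd CARD('a)" using CHAR_dvd_CARD[where 'a = 'a] by simp
  moreover have "odd CARD('a)" using assms unfolding cong_def by presburger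
  ultimately show False by simp
qed

lemma card_sqrts:
  fixes d :: "'a::{field,finite}"
  assumes "(2::'a) \<noteq> 0"
  shows "int (card {z. z\<^sup>2 = d}) = 1 + quadratic_character d"
proof (cases "\<exists>y. d = y\<^sup>2")
  case True
  then obtain y where y: "d = y\<^sup>2" by blast
  have *: "{z. z\<^sup>2 = d} = {y, - y}" using y by (auto simp: power2_eq_iff)
  show ?thesis
  proof (cases "y = 0")
    case False
    have "y \<noteq> - y"
    proof
      assume "y = - y"
      then have "2 * y = 0" by (metis mult_2 add.right_inverse)
      then show False using False assms by simp
    qed
    then show ?thesis using False y by (subst *) (auto simp: quadratic_character_def)
  qed (use y * in \<open>simp add: quadratic_character_def\<close>)
next
  case False
  then have "{z. z\<^sup>2 = d} = {}" "d \<noteq> 0" by (auto intro: exI[of _ 0])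
  then show ?thesis using False by (simp add: quadratic_character_def)
qed

text \<open>The fibres of squaring partition the field, so the root counts
  \<open>1 + quadratic_character x\<close> add up to its order.\<close>

lemma sum_quadratic_character:
  assumes "(2::'a::{field,finite}) \<noteq> 0"
  shows "(\<Sum>x::'a\<in>UNIV. quadratic_character x) = 0"
proof -
  have "(\<Sum>x::'a\<in>UNIV. 1 + quadratic_character x) = (\<Sum>x::'a\<in>UNIV. int (card {z. z\<^sup>2 = x}))"
    by (simp add: card_sqrts[OF assms])
  also have "\<dots> = int (card (\<Union>x::'a. {z. z\<^sup>2 = x}))"
    by (subst card_UN_disjoint) auto
  also have "(\<Union>x::'a. {z. z\<^sup>2 = x}) = UNIV" by auto
  finally show ?thesis by (simp add: sum.distrib)
qed

lemma quadratic_character_0 [simp]: "quadratic_character 0 = 0"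
  and quadratic_character_1 [simp]: "quadratic_character 1 = 1"
  by (auto simp: quadratic_character_def intro: exI[of _ 1])

lemma quadratic_character_square: "x \<noteq> 0 \<Longrightarrow> quadratic_character (x\<^sup>2) = 1"
  by (auto simp: quadratic_character_def)

lemma quadratic_character_cases:
  "x \<noteq> 0 \<Longrightarrow> quadratic_character x = 1 \<or> quadratic_character x = - 1"
  by (auto simp: quadratic_character_def)

lemma quadratic_character_mult_square:
  assumes "y \<noteq> 0"
  shows "quadratic_character (y\<^sup>2 * x) = quadratic_character x"
proof -
  have "(\<exists>z. y\<^sup>2 * x = z\<^sup>2) \<longleftrightarrow> (\<exists>z. x = z\<^sup>2)"
  proof
    assume "\<exists>z. y\<^sup>2 * x = z\<^sup>2"
    then obtain z where "y\<^sup>2 * x = z\<^sup>2" ..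
    then have "x = (z / y)\<^sup>2" using assms by (simp add: power_divide field_simps)
    then show "\<exists>z. x = z\<^sup>2" ..
  qed (metis power_mult_distrib)
  then show ?thesis using assms by (simp add: quadratic_character_def)
qed

text \<open>For a nonsquare \<open>x\<close> the function \<open>y \<mapsto> \<chi> (x y) + \<chi> y\<close> sums to zero and is never
  positive, since \<open>x y\<close> is a nonsquare whenever \<open>y\<close> is a nonzero square.\<close>

lemma quadratic_character_mult:
  fixes x y :: "'a::{field,finite}"
  assumes 2: "(2::'a) \<noteq> 0"
  shows "quadratic_character (x * y) = quadratic_character x * quadratic_character y"
proof (cases "x = 0 \<or> (\<exists>z. x = z\<^sup>2)")
  case True
  then show ?thesis
  proof
    assume "\<exists>z. x = z\<^sup>2"
    then obtain z where z: "x = z\<^sup>2" ..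
    then show ?thesis
      by (cases "z = 0") (auto simp: quadratic_character_mult_square quadratic_character_square)
  qed simp
next
  case False
  then have x: "x \<noteq> 0" "quadratic_character x = - 1" by (auto simp: quadratic_character_def)
  let ?g = "\<lambda>y. - (quadratic_character (x * y) + quadratic_character y)"
  have nonneg: "?g y \<ge> 0" for y
  proof (cases "y \<noteq> 0 \<and> (\<exists>z. y = z\<^sup>2)")
    case True
    then obtain z where "y = z\<^sup>2" "z \<noteq> 0" by auto
    then have "quadratic_character (x * y) = - 1" "quadratic_character y = 1"
      using quadratic_character_mult_square[of z x] x
      by (simp_all add: mult.commute quadratic_character_square)
    then show ?thesis by simp
  qed (auto simp: quadratic_character_def)
  have "(\<Sum>y\<in>UNIV. quadratic_character (x * y)) = (\<Sum>y::'a\<in>UNIV. quadratic_character y)"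
    by (rule sum.reindex_bij_witness[of _ "\<lambda>y. y / x" "\<lambda>y. x * y"]) (use x in auto)
  then have "(\<Sum>y\<in>UNIV. ?g y) = 0"
    by (simp add: sum_negf sum_subtractf sum.distrib sum_quadratic_character[OF 2])
  then have "?g y = 0" using nonneg by (subst (asm) sum_nonneg_eq_0_iff) auto
  then show ?thesis using x by simp
qed

text \<open>After a translation, \<open>a * (a + d) = a^2 * (1 + d / a)\<close> for
  \<open>a \<noteq> 0\<close>, and \<open>1 + d / a\<close> takes every value except 1. As the full
  character sum is zero, minus the value at 1 remains.\<close>

lemma sum_quadratic_character_shift:
  fixes b c :: "'a::{field,finite}"
  assumes 2: "(2::'a) \<noteq> 0" and "b \<noteq> c"
  shows "(\<Sum>a\<in>UNIV. quadratic_character (b + a) * quadratic_character (c + a)) = - 1"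
proof -
  let ?c = "quadratic_character :: 'a \<Rightarrow> int"
  define d where "d = c - b"
  have d: "d \<noteq> 0" using assms by (simp add: d_def)
  have "(\<Sum>a\<in>UNIV. ?c (b + a) * ?c (c + a)) = (\<Sum>a\<in>UNIV. ?c a * ?c (a + d))"
    by (rule sum.reindex_bij_witness[of _ "\<lambda>a. a - b" "\<lambda>a. b + a"])
       (auto simp: d_def algebra_simps)
  also have "\<dots> = (\<Sum>a\<in>UNIV - {0}. ?c a * ?c (a + d))"
    by (rule sum.mono_neutral_right) auto
  also have "\<dots> = (\<Sum>a\<in>UNIV - {1}. ?c a)"
  proof (rule sum.reindex_bij_witness[of _ "\<lambda>a. d / (a - 1)" "\<lambda>a. 1 + d / a"])
    fix a :: 'a assume "a \<in> UNIV - {0}"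
    then have a: "a \<noteq> 0" by simp
    have "?c a * ?c (a + d) = ?c (a * (a + d))" by (simp add: quadratic_character_mult[OF 2])
    also have "a * (a + d) = a\<^sup>2 * (1 + d / a)" using a by (simp add: field_simps power2_eq_square)
    finally show "?c (1 + d / a) = ?c a * ?c (a + d)"
      using a by (simp add: quadratic_character_mult_square)
  qed (use d in auto)
  also have "\<dots> = - 1"
    using sum_quadratic_character[OF 2] by (simp add: sum_diff1)
  finally show ?thesis .
qed

lemma sum_quadratic_character_power2:
  fixes b :: "'a::{field,finite}"
  shows "(\<Sum>a\<in>UNIV. quadratic_character (b + a) * quadratic_character (b + a)) = int CARD('a) - 1"
proof -
  have "(\<Sum>a\<in>UNIV. quadratic_character (b + a) * quadratic_character (b + a))
      = (\<Sum>a::'a\<in>UNIV. if a = - b then 0 else 1)"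
  proof (rule sum.cong)
    fix a
    show "quadratic_character (b + a) * quadratic_character (b + a) = (if a = - b then 0 else 1)"
      using quadratic_character_cases[of "b + a"] by (auto simp: add_eq_0_iff)
  qed simp
  also have "\<dots> = int (card (UNIV - {- b}))"
    by (subst sum.If_cases) (auto simp: Compl_eq_Diff_UNIV)
  finally show ?thesis by (simp add: card_Diff_singleton int_ops Suc_leI)
qed

section \<open>A Hasse bound for the curves \<open>y\<^sup>2 = x\<^sup>3 + a x\<close>\<close>

text \<open>In odd characteristic, q plus this sum is the number of affine points on the curve. The
  two characters stay separate so that summing over \<open>a\<close> meets only
  \<open>s^2 + a\<close>.\<close>

definition cubic_sum :: "'a::{field,finite} \<Rightarrow> int" where
  "cubic_sum a = (\<Sum>s\<in>UNIV. quadratic_character s * quadratic_character (s\<^sup>2 + a))"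

text \<open>Substituting \<open>t * s\<close> for \<open>s\<close> pulls \<open>t^3\<close> out of
  the cubic, and its character is that of \<open>t\<close>. Hence \<open>(cubic_sum a)^2\<close> is
  the same at all nonzero squares \<open>a\<close>.\<close>

lemma cubic_sum_twist:
  fixes a t :: "'a::{field,finite}"
  assumes 2: "(2::'a) \<noteq> 0" and t: "t \<noteq> 0"
  shows "cubic_sum (t\<^sup>2 * a) = quadratic_character t * cubic_sum a"
proof -
  let ?c = "quadratic_character :: 'a \<Rightarrow> int"
  have "cubic_sum (t\<^sup>2 * a) = (\<Sum>s\<in>UNIV. ?c t * (?c s * ?c (s\<^sup>2 + a)))"
    unfolding cubic_sum_def
  proof (rule sum.reindex_bij_witness[of _ "\<lambda>s. t * s" "\<lambda>s. s / t"])
    fix s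
    have *: "s = t * (s / t)" "s\<^sup>2 + t\<^sup>2 * a = t\<^sup>2 * ((s / t)\<^sup>2 + a)"
      using t by (simp_all add: field_simps power2_eq_square)
    have "?c s = ?c t * ?c (s / t)" using * quadratic_character_mult[OF 2] by metis
    moreover have "?c (s\<^sup>2 + t\<^sup>2 * a) = ?c ((s / t)\<^sup>2 + a)"
      using * quadratic_character_mult_square[OF t] by metis
    ultimately show "?c t * (?c (s / t) * ?c ((s / t)\<^sup>2 + a)) = ?c s * ?c (s\<^sup>2 + t\<^sup>2 * a)"
      by simp
  qed (use t in auto)
  then show ?thesis by (simp add: cubic_sum_def sum_distrib_left)
qed

text \<open>Expand the square and sum over \<open>a\<close> first: the result is -1, plus q if
  \<open>s^2 = t^2\<close>. The -1 contributes nothing because the character sums to zero; each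
  \<open>s \<noteq> 0\<close> leaves the terms \<open>t = s\<close> and \<open>t = - s\<close>,
  which are equal because -1 is a square.\<close>

lemma sum_cubic_sum_power2:
  assumes 2: "(2::'a::{field,finite}) \<noteq> 0" and m1: "quadratic_character (- 1 :: 'a) = 1"
  shows "(\<Sum>a::'a\<in>UNIV. (cubic_sum a)\<^sup>2) = 2 * int CARD('a) * (int CARD('a) - 1)"
proof -
  let ?c = "quadratic_character :: 'a \<Rightarrow> int" and ?q = "int CARD('a)"
  have inner: "(\<Sum>a\<in>UNIV. ?c (s\<^sup>2 + a) * ?c (t\<^sup>2 + a)) = (if s\<^sup>2 = t\<^sup>2 then ?q else 0) - 1" for s t
    by (auto simp: sum_quadratic_character_power2 sum_quadratic_character_shift[OF 2])
  have diag: "(\<Sum>t\<in>UNIV. ?c s * ?c t * (if s\<^sup>2 = t\<^sup>2 then ?q else 0))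
      = (if s = 0 then 0 else 2 * ?q)" for s
  proof (cases "s = 0")
    case False
    have neq: "s \<noteq> - s"
    proof
      assume "s = - s"
      then have "2 * s = 0" by (metis mult_2 add.right_inverse)
      then show False using False 2 by simp
    qed
    have neg: "?c (- s) = ?c s" using quadratic_character_mult[OF 2, of "- 1" s] m1 by simp
    have "(\<Sum>t\<in>UNIV. ?c s * ?c t * (if s\<^sup>2 = t\<^sup>2 then ?q else 0))
        = (\<Sum>t\<in>{s, - s}. ?c s * ?c t * (if s\<^sup>2 = t\<^sup>2 then ?q else 0))"
      by (rule sum.mono_neutral_right) (auto simp: power2_eq_iff)
    also have "\<dots> = 2 * ?q * (?c s * ?c s)" using neq neg by (simp add: algebra_simps)
    also have "?c s * ?c s = 1" using quadratic_character_cases[OF False] by auto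
    finally show ?thesis using False by simp
  qed simp
  have "(\<Sum>a::'a\<in>UNIV. (cubic_sum a)\<^sup>2)
      = (\<Sum>a\<in>UNIV. \<Sum>s\<in>UNIV. \<Sum>t\<in>UNIV. ?c s * ?c t * (?c (s\<^sup>2 + a) * ?c (t\<^sup>2 + a)))"
    by (simp add: cubic_sum_def power2_eq_square sum_product mult_ac)
  also have "\<dots> = (\<Sum>s\<in>UNIV. \<Sum>a\<in>UNIV. \<Sum>t\<in>UNIV. ?c s * ?c t * (?c (s\<^sup>2 + a) * ?c (t\<^sup>2 + a)))"
    by (rule sum.swap)
  also have "\<dots> = (\<Sum>s\<in>UNIV. \<Sum>t\<in>UNIV. \<Sum>a\<in>UNIV. ?c s * ?c t * (?c (s\<^sup>2 + a) * ?c (t\<^sup>2 + a)))"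
    by (intro sum.cong refl sum.swap)
  also have "\<dots> = (\<Sum>s\<in>UNIV. \<Sum>t\<in>UNIV. ?c s * ?c t * ((if s\<^sup>2 = t\<^sup>2 then ?q else 0) - 1))"
    by (simp only: inner flip: sum_distrib_left)
  also have "\<dots> = (\<Sum>s\<in>UNIV. (\<Sum>t\<in>UNIV. ?c s * ?c t * (if s\<^sup>2 = t\<^sup>2 then ?q else 0))
                               - ?c s * (\<Sum>t\<in>UNIV. ?c t))"
    by (simp only: right_diff_distrib sum_subtractf mult_1_right sum_distrib_left)
  also have "\<dots> = (\<Sum>s::'a\<in>UNIV. if s = 0 then 0 else 2 * ?q)"
    by (simp only: diag sum_quadratic_character[OF 2]) simp
  also have "\<dots> = (\<Sum>s\<in>UNIV - {0::'a}. 2 * ?q)"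
    by (rule sum.mono_neutral_cong_right) auto
  also have "\<dots> = 2 * ?q * (?q - 1)" by (simp add: card_Diff_singleton int_ops Suc_leI)
  finally show ?thesis .
qed

lemma cubic_sum_bound:
  assumes 2: "(2::'a::{field,finite}) \<noteq> 0" and m1: "quadratic_character (- 1 :: 'a) = 1"
  shows "(cubic_sum (1::'a))\<^sup>2 \<le> 4 * int CARD('a)"
proof -
  let ?c = "quadratic_character :: 'a \<Rightarrow> int" and ?q = "int CARD('a)"
  have "card {0, 1 :: 'a} \<le> CARD('a)" by (rule card_mono) auto
  then have q1: "?q > 1" by simp
  \<comment> \<open>The weight \<open>1 + ?c a\<close> is 2 at nonzero squares, where the twist
    applies, and 0 at nonsquares. Over all \<open>a \<noteq> 0\<close> the weights add up to q -
    1.\<close>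
  have eq: "(1 + ?c a) * (cubic_sum a)\<^sup>2 = (1 + ?c a) * (cubic_sum (1::'a))\<^sup>2" if "a \<noteq> 0" for a :: 'a
  proof (cases "?c a = 1")
    case True
    then obtain t where t: "a = t\<^sup>2" "t \<noteq> 0"
      by (auto simp: quadratic_character_def split: if_splits)
    then show ?thesis using cubic_sum_twist[OF 2 t(2), of 1] quadratic_character_cases[OF t(2)] by auto
  qed (use quadratic_character_cases[OF that] in auto)
  have "(?q - 1) * (cubic_sum (1::'a))\<^sup>2 = (\<Sum>a\<in>UNIV - {0}. (1 + ?c a) * (cubic_sum (1::'a))\<^sup>2)"
    using sum_quadratic_character[OF 2]
    by (simp add: sum.distrib sum_diff1 card_Diff_singleton int_ops Suc_leI flip: sum_distrib_right)
  also have "\<dots> = (\<Sum>a\<in>UNIV - {0}. (1 + ?c a) * (cubic_sum a)\<^sup>2)"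
    by (intro sum.cong) (simp_all add: eq)
  also have "\<dots> \<le> (\<Sum>a::'a\<in>UNIV - {0}. 2 * (cubic_sum a)\<^sup>2)"
    by (intro sum_mono mult_right_mono) (auto simp: quadratic_character_def)
  also have "\<dots> \<le> (\<Sum>a::'a\<in>UNIV. 2 * (cubic_sum a)\<^sup>2)"
    by (intro sum_mono2) auto
  also have "\<dots> = (?q - 1) * (4 * ?q)"
    by (simp add: sum_cubic_sum_power2[OF assms] flip: sum_distrib_left)
  finally show ?thesis using q1 by simp
qed

section \<open>Existence of an admissible \<open>s2\<close>\<close>

lemma s1_s3_mult:
  fixes e f s :: "'a::field"
  assumes 2: "(2::'a) \<noteq> 0" and e: "e ^ 4 = 1" and f: "f\<^sup>2 = - 1"
  shows "s1 e f s * s3 e f s = (s\<^sup>2 + 1) / 2"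
proof -
  \<comment> \<open>Since \<open>c * c = - 1\<close>, the difference of squares becomes
    \<open>(1 + s)^2 + (1 - s)^2\<close>.\<close>
  define c where "c = f / e\<^sup>2"
  have c: "c * c = - 1" using e f
    by (simp add: c_def power_divide power2_eq_square power4_eq_xxxx mult.assoc)
  have "s1 e f s = ((1 + s) + c * (1 - s)) / 2" "s3 e f s = ((1 + s) - c * (1 - s)) / 2"
    by (simp_all add: s1_def s3_def c_def)
  then have "s1 e f s * s3 e f s = ((1 + s) + c * (1 - s)) * ((1 + s) - c * (1 - s)) / (2 * 2)"
    by (simp only: times_divide_times_eq)
  also have "((1 + s) + c * (1 - s)) * ((1 + s) - c * (1 - s))
      = (1 + s) * (1 + s) - (c * c) * ((1 - s) * (1 - s))"
    by (simp add: algebra_simps)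
  also have "\<dots> = 2 * (s\<^sup>2 + 1)"
    unfolding c by (simp add: power2_eq_square algebra_simps)
  also have "2 * (s\<^sup>2 + 1) / (2 * 2) = (s\<^sup>2 + 1) / 2"
    using 2 by (rule mult_divide_mult_cancel_left)
  finally show ?thesis .
qed

lemma exists_s2:
  fixes e f :: "'a::{field,finite}"
  assumes 2: "(2::'a) \<noteq> 0" and q: "CARD('a) > 9" and e: "e ^ 4 = 1" and f: "f\<^sup>2 = - 1"
  shows "\<exists>s2. s2 \<noteq> 0 \<and> quadratic_character (s1 e f s2 * s2 * s3 e f s2) = - 1"
proof (rule ccontr)
  let ?c = "quadratic_character :: 'a \<Rightarrow> int" and ?q = "int CARD('a)"
  assume neg: "\<not> ?thesis"
  have m1: "?c (- 1) = 1" using f quadratic_character_square[of f] by fastforce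
  have prod: "s1 e f s * s * s3 e f s = s * (s\<^sup>2 + 1) / 2" for s
  proof -
    have "s1 e f s * s * s3 e f s = s * (s1 e f s * s3 e f s)" by (simp only: mult_ac)
    then show ?thesis unfolding s1_s3_mult[OF 2 e f] by simp
  qed
  \<comment> \<open>The excluded values are the roots of \<open>s * (s^2 + 1)\<close>; elsewhere the
    character is nonzero, hence 1 by \<open>neg\<close>.\<close>
  have one: "?c (1 / 2) * (?c s * ?c (s\<^sup>2 + 1)) = 1" if s: "s \<notin> {0, f, - f}" for s
  proof -
    have "s\<^sup>2 + 1 = s\<^sup>2 - f\<^sup>2" using f by simp
    then have "s\<^sup>2 + 1 = (s - f) * (s + f)" by (simp add: power2_eq_square algebra_simps)
    then have "s\<^sup>2 + 1 \<noteq> 0" using s by (auto simp: add_eq_0_iff2)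
    then have nz: "s * (s\<^sup>2 + 1) / 2 \<noteq> 0" using s 2 by auto
    have "?c (s * (s\<^sup>2 + 1) / 2) \<noteq> - 1" using neg s prod by auto
    then have "?c (s * (s\<^sup>2 + 1) / 2) = 1" using quadratic_character_cases[OF nz] by auto
    moreover have "s * (s\<^sup>2 + 1) / 2 = 1 / 2 * (s * (s\<^sup>2 + 1))" by simp
    ultimately show ?thesis by (metis quadratic_character_mult[OF 2])
  qed
  have "?c (1 / 2) * cubic_sum (1::'a) = (\<Sum>s\<in>UNIV. ?c (1 / 2) * (?c s * ?c (s\<^sup>2 + 1)))"
    by (simp add: cubic_sum_def sum_distrib_left)
  also have "\<dots> = (\<Sum>s\<in>UNIV - {0, f, - f}. 1)"
    by (rule sum.mono_neutral_cong_right) (use one f in auto)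
  also have "\<dots> = int (card (UNIV - {0, f, - f}))" by simp
  also have "\<dots> \<ge> ?q - 3"
  proof -
    have "CARD('a) - card {0, f, - f} \<le> card (UNIV - {0, f, - f})" by (rule diff_card_le_card_Diff) simp
    moreover have "card {0, f, - f} \<le> 3" by (simp add: card_insert_if)
    ultimately show ?thesis by linarith
  qed
  finally have ge: "?c (1 / 2) * cubic_sum (1::'a) \<ge> ?q - 3" .
  have "?c (1 / 2) = 1 \<or> ?c (1 / 2) = - 1" using quadratic_character_cases[of "1 / 2 :: 'a"] 2 by simp
  then have "(?c (1 / 2) * cubic_sum (1::'a))\<^sup>2 = (cubic_sum (1::'a))\<^sup>2" by auto
  moreover have "(?q - 3)\<^sup>2 \<le> (?c (1 / 2) * cubic_sum (1::'a))\<^sup>2"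
    using ge q by (intro power_mono) auto
  ultimately have "(?q - 3)\<^sup>2 \<le> 4 * ?q" using cubic_sum_bound[OF 2 m1] by simp
  \<comment> \<open>\<open>(q - 3)^2 - 4 q\<close> factors in this way, which is positive for q >
    9.\<close>
  then have "(?q - 1) * (?q - 9) \<le> 0" by (simp add: power2_eq_square algebra_simps)
  moreover have "(?q - 1) * (?q - 9) > 0" using q by simp
  ultimately show False by simp
qed

section \<open>Counting representations\<close>

text \<open>Indexed by the exponent of \<open>x\<close>, with 1 for the first parabola, so that the
  four parts of R share one formula and indices add modulo 4.\<close>

definition s_coeff :: "'a::field \<Rightarrow> 'a \<Rightarrow> 'a \<Rightarrow> nat \<Rightarrow> 'a" where
  "s_coeff e f s2 j = [1, s1 e f s2, s2, s3 e f s2] ! j"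

lemma less_4_cases:
  assumes "(j::nat) < 4"
  obtains "j = 0" | "j = 1" | "j = 2" | "j = 3"
  using assms by linarith

lemma setR_eq:
  "setR e f s2 = (\<lambda>(j, y). ((y, inverse (s_coeff e f s2 j) * y\<^sup>2), j)) ` ({..<4} \<times> UNIV)"
proof -
  have part: "embH ` parabola s #>\<^bsub>semidirect e f\<^esub> ((0, 0), i) = {((y, inverse s * y\<^sup>2), i) | y. True}"
    if "i < 4" for s :: 'a and i
    using that by (auto simp: r_coset_def embH_def parabola_def semidirect_def)
  have "{(y, y\<^sup>2) | y::'a. True} = parabola 1" by (simp add: parabola_def)
  then have first: "embH ` {(y, y\<^sup>2) | y::'a. True} = {((y, inverse 1 * y\<^sup>2), 0) | y. True}"
    by (auto simp: embH_def parabola_def)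
  have four: "{..<4} = {0, 1, 2, 3 :: nat}" by auto
  have "(\<lambda>(j, y). ((y, inverse (s_coeff e f s2 j) * y\<^sup>2), j)) ` ({..<4} \<times> UNIV)
      = (\<Union>j\<in>{..<4}. {((y, inverse (s_coeff e f s2 j) * y\<^sup>2), j) | y. True})"
    by fastforce
  also have "\<dots> = setR e f s2"
    unfolding setR_def first four
    by (simp add: genx_pow part s_coeff_def Un_assoc) (simp add: genx_def part)
  finally show ?thesis by simp
qed

lemma card_setR: "card (setR e f (s2 :: 'a::{field,finite})) = 4 * CARD('a)"
  unfolding setR_eq by (subst card_image) (auto simp: inj_on_def card_cartesian_product)

text \<open>Complete the square: \<open>y\<close> solves the equation iff \<open>a * y + b\<close>
  is a square root of \<open>b^2 - a * c\<close>. The even middle coefficient avoids a factor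
  4.\<close>

lemma quadratic_solution_count:
  fixes a b c :: "'a::{field,finite}"
  assumes "(2::'a) \<noteq> 0" and a: "a \<noteq> 0"
  shows "int (card {y. a * y\<^sup>2 + 2 * b * y + c = 0}) = 1 + quadratic_character (b\<^sup>2 - a * c)"
proof -
  have "a * y\<^sup>2 + 2 * b * y + c = 0 \<longleftrightarrow> (a * y + b)\<^sup>2 = b\<^sup>2 - a * c" for y
  proof -
    have "(a * y + b)\<^sup>2 - (b\<^sup>2 - a * c) = a * (a * y\<^sup>2 + 2 * b * y + c)"
      by (simp add: power2_eq_square algebra_simps)
    then show ?thesis using a by (metis mult_eq_0_iff right_minus_eq)
  qed
  then have "bij_betw (\<lambda>y. a * y + b) {y. a * y\<^sup>2 + 2 * b * y + c = 0} {z. z\<^sup>2 = b\<^sup>2 - a * c}"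
    using a by (intro bij_betwI[where g = "\<lambda>z. (z - b) / a"]) simp_all
  then show ?thesis using card_sqrts[OF assms(1)] by (simp add: bij_betw_same_card)
qed

text \<open>A pair is determined by \<open>r2\<close>, as \<open>r1\<close> must be the product of
  \<open>g\<close> and \<open>r2\<close>; this removes inverses from the counting.\<close>

lemma card_difference_pairs:
  assumes "group G" "R \<subseteq> carrier G" "g \<in> carrier G"
  shows "card {(r1, r2). r1 \<in> R \<and> r2 \<in> R \<and> g = r1 \<otimes>\<^bsub>G\<^esub> inv\<^bsub>G\<^esub> r2}
       = card {r \<in> R. g \<otimes>\<^bsub>G\<^esub> r \<in> R}"
proof -
  interpret group G by fact
  have "g = r1 \<otimes>\<^bsub>G\<^esub> inv\<^bsub>G\<^esub> r2 \<longleftrightarrow> r1 = g \<otimes>\<^bsub>G\<^esub> r2" if "r1 \<in> R" "r2 \<in> R" for r1 r2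
    using that assms inv_solve_right[of g r1 r2] by blast
  then have "(r1 \<in> R \<and> r2 \<in> R \<and> g = r1 \<otimes>\<^bsub>G\<^esub> inv\<^bsub>G\<^esub> r2)
      \<longleftrightarrow> r1 = g \<otimes>\<^bsub>G\<^esub> r2 \<and> r2 \<in> R \<and> g \<otimes>\<^bsub>G\<^esub> r2 \<in> R" for r1 r2
    by metis
  then have "{(r1, r2). r1 \<in> R \<and> r2 \<in> R \<and> g = r1 \<otimes>\<^bsub>G\<^esub> inv\<^bsub>G\<^esub> r2}
      = (\<lambda>r. (g \<otimes>\<^bsub>G\<^esub> r, r)) ` {r \<in> R. g \<otimes>\<^bsub>G\<^esub> r \<in> R}"
    by (simp only:) auto
  then show ?thesis by (simp add: card_image inj_on_def)
qed

section \<open>Relations between the coefficients \<open>s j\<close>\<close>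

locale rds_parameters =
  fixes e f s2 :: "'a::{field,finite}"
  assumes two: "(2::'a) \<noteq> 0" and e4: "e ^ 4 = 1" and f2: "f\<^sup>2 = - 1"
    and nonsquare: "quadratic_character (s1 e f s2 * s2 * s3 e f s2) = - 1"
begin

abbreviation s :: "nat \<Rightarrow> 'a" where "s \<equiv> s_coeff e f s2"

abbreviation eta :: "'a \<Rightarrow> int" where "eta \<equiv> quadratic_character"

lemma s_nonzero: "j < 4 \<Longrightarrow> s j \<noteq> 0"
  using nonsquare by (elim less_4_cases) (auto simp: s_coeff_def)

text \<open>At \<open>s2 = - 1\<close> the product of \<open>s1\<close>, \<open>s2\<close>,
  \<open>s3\<close> would be -1, a nonzero square. The factor \<open>1 + s2\<close> occurs in the
  leading coefficients below.\<close>

lemma sum_s_nonzero: "1 + s2 \<noteq> 0"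
proof
  assume "1 + s2 = 0"
  then have "s2 = - 1" by (simp add: add_eq_0_iff)
  then have "s1 e f s2 * s2 * s3 e f s2 = f\<^sup>2"
    using s1_s3_mult[OF two e4 f2, of s2] two f2 by simp
  moreover have "f \<noteq> 0" using f2 by auto
  ultimately show False using nonsquare quadratic_character_square[of f] by simp
qed

lemma e_square_cases: "e\<^sup>2 = 1 \<or> e\<^sup>2 = - 1"
proof -
  have "(e\<^sup>2)\<^sup>2 = 1" using e4 by (simp flip: power_mult)
  then show ?thesis by (simp only: power2_eq_1_iff)
qed

lemma inverse_f: "inverse f = - f"
  using f2 by (intro inverse_unique) (simp add: power2_eq_square)

text \<open>With \<epsilon> = \<open>e^2\<close>, twice the common value is
  \<open>c * (1 + s2)\<close>, where c is \<epsilon> + f, 2, \<epsilon> - f for k = 1, 2, 3.\<close>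

lemma leading_coeff_const:
  assumes "0 < k" "k < 4"
  obtains t where "t \<noteq> 0"
    "\<And>j. j < 4 \<Longrightarrow> (inverse e ^ k)\<^sup>2 * s j - inverse f ^ k * s ((k + j) mod 4) = t"
proof -
  define \<epsilon> where "\<epsilon> = e\<^sup>2"
  have \<epsilon>: "\<epsilon> * \<epsilon> = 1" "inverse \<epsilon> = \<epsilon>" using e_square_cases unfolding \<epsilon>_def[symmetric] by auto
  then have \<epsilon>': "\<epsilon> * (\<epsilon> * x) = x" for x by (simp flip: mult.assoc)
  have ff: "f * f = - 1" using f2 by (simp add: power2_eq_square)
  then have ff': "f * (f * x) = - x" for x by (simp flip: mult.assoc)
  have E: "(inverse e ^ k)\<^sup>2 = \<epsilon> ^ k"
    by (metis \<epsilon>(2) \<epsilon>_def power_inverse power_mult mult.commute)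
  \<comment> \<open>The doubled coefficients \<open>2 * s j\<close>, free of division, so that each
    case reduces to \<epsilon> * \<epsilon> = 1 and \<open>f * f = - 1\<close>.\<close>
  define d where "d = [2, (1 + s2) + f * \<epsilon> * (1 - s2), 2 * s2, (1 + s2) - f * \<epsilon> * (1 - s2)]"
  have d: "2 * s j = d ! j" if "j < 4" for j
  proof -
    have "f / e\<^sup>2 = f * \<epsilon>" using \<epsilon>(2) by (simp add: \<epsilon>_def divide_inverse)
    then show ?thesis
      using two by (cases rule: less_4_cases[OF that]) (simp_all add: s_coeff_def d_def s1_def s3_def)
  qed
  have nz: "\<epsilon> + f \<noteq> 0" "\<epsilon> - f \<noteq> 0"
  proof -
    have "(\<epsilon> + f) * (\<epsilon> - f) = 2" using \<epsilon> ff by (simp add: algebra_simps)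
    then show "\<epsilon> + f \<noteq> 0" "\<epsilon> - f \<noteq> 0" using two by auto
  qed
  have "\<exists>c. c \<noteq> 0 \<and> (\<forall>j<4. \<epsilon> ^ k * d ! j - (- f) ^ k * d ! ((k + j) mod 4) = c * (1 + s2))"
    using assms(2)
  proof (cases rule: less_4_cases)
    case 1
    then show ?thesis using assms by simp
  next
    case 2
    have "\<epsilon> ^ k * d ! j - (- f) ^ k * d ! ((k + j) mod 4) = (\<epsilon> + f) * (1 + s2)" if "j < 4" for j
      using that by (cases rule: less_4_cases) (simp_all add: 2 d_def algebra_simps \<epsilon> \<epsilon>' ff ff')
    then show ?thesis using nz by blast
  next
    case 3
    have "\<epsilon> ^ k * d ! j - (- f) ^ k * d ! ((k + j) mod 4) = 2 * (1 + s2)" if "j < 4" for j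
      using that by (cases rule: less_4_cases)
        (simp_all add: 3 d_def power2_eq_square algebra_simps \<epsilon> \<epsilon>' ff ff')
    then show ?thesis using two by blast
  next
    case 4
    have "\<epsilon> ^ k * d ! j - (- f) ^ k * d ! ((k + j) mod 4) = (\<epsilon> - f) * (1 + s2)" if "j < 4" for j
      using that by (cases rule: less_4_cases)
        (simp_all add: 4 d_def power3_eq_cube algebra_simps \<epsilon> \<epsilon>' ff ff')
    then show ?thesis using nz by blast
  qed
  then obtain c where c: "c \<noteq> 0"
    and h: "\<And>j. j < 4 \<Longrightarrow> \<epsilon> ^ k * d ! j - (- f) ^ k * d ! ((k + j) mod 4) = c * (1 + s2)" by blast
  show thesis
  proof (rule that[of "c * (1 + s2) / 2"])
    show "c * (1 + s2) / 2 \<noteq> 0" using c two sum_s_nonzero by simp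
    fix j :: nat assume j: "j < 4"
    have "2 * (\<epsilon> ^ k * s j - (- f) ^ k * s ((k + j) mod 4))
        = \<epsilon> ^ k * (2 * s j) - (- f) ^ k * (2 * s ((k + j) mod 4))"
      by (simp only: right_diff_distrib mult.left_commute)
    also have "\<dots> = c * (1 + s2)" using d[OF j] d[of "(k + j) mod 4"] h[OF j] by simp
    finally show "(inverse e ^ k)\<^sup>2 * s j - inverse f ^ k * s ((k + j) mod 4) = c * (1 + s2) / 2"
      using two unfolding E inverse_f by (metis nonzero_mult_div_cancel_left)
  qed
qed

text \<open>Write h_j for the character of \<open>s j\<close>; the product of all four is -1. For
  odd k the sum is (h_0 + h_2) (h_1 + h_3), where one factor vanishes; for k = 2 it is 2 (h_0 h_2 +
  h_1 h_3), with summands of opposite sign.\<close>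

lemma sum_eta_s:
  assumes "0 < k" "k < 4"
  shows "(\<Sum>j<4. eta (s j * s ((k + j) mod 4))) = 0"
proof -
  have prod: "eta (s 1) * eta (s 2) * eta (s 3) = - 1" "eta (s 0) = 1"
    using nonsquare by (simp_all add: s_coeff_def quadratic_character_mult[OF two])
  have pm: "eta (s j) = 1 \<or> eta (s j) = - 1" if "j < 4" for j
    using quadratic_character_cases[OF s_nonzero[OF that]] .
  have split: "(\<Sum>j<4. h j) = h 0 + h 1 + h 2 + h 3" for h :: "nat \<Rightarrow> int"
    by (simp add: eval_nat_numeral)
  show ?thesis
    unfolding quadratic_character_mult[OF two] split using assms(2)
  proof (cases rule: less_4_cases)
    case 1
    then show "eta (s 0) * eta (s ((k + 0) mod 4)) + eta (s 1) * eta (s ((k + 1) mod 4))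
        + eta (s 2) * eta (s ((k + 2) mod 4)) + eta (s 3) * eta (s ((k + 3) mod 4)) = 0"
      using assms by simp
  qed (use prod pm[of 1] pm[of 2] pm[of 3] in \<open>auto simp flip: numeral_2_eq_2\<close>)
qed

section \<open>Translates of R by a group element\<close>

lemma card_translate:
  assumes "k < 4"
  shows "card {r \<in> setR e f s2. ((u, v), k) \<otimes>\<^bsub>semidirect e f\<^esub> r \<in> setR e f s2}
    = (\<Sum>j<4. card {y. v + inverse f ^ k * (inverse (s j) * y\<^sup>2)
                       = inverse (s ((k + j) mod 4)) * (u + inverse e ^ k * y)\<^sup>2})"
    (is "card ?A = (\<Sum>j<4. card (?Y j))")
proof -
  \<comment> \<open>Translation sends index \<open>j\<close> to \<open>(k + j) mod 4\<close> and
    fixes the new first coordinate, so only the equation of second coordinates remains.\<close>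
  have "?A = (\<lambda>(j, y). ((y, inverse (s j) * y\<^sup>2), j)) ` (SIGMA j:{..<4}. ?Y j)"
    unfolding setR_eq by (auto simp: semidirect_def image_iff)
  then have "card ?A = card (SIGMA j:{..<4}. ?Y j)"
    by (simp add: card_image inj_on_def split: prod.splits)
  then show ?thesis by simp
qed

lemma count_outside_H:
  assumes k: "0 < k" "k < 4"
  shows "card {r \<in> setR e f s2. ((u, v), k) \<otimes>\<^bsub>semidirect e f\<^esub> r \<in> setR e f s2} = 4"
proof -
  define E F where "E = inverse e ^ k" and "F = inverse f ^ k"
  obtain t where t: "t \<noteq> 0"
    and lead: "\<And>j. j < 4 \<Longrightarrow> E\<^sup>2 * s j - F * s ((k + j) mod 4) = t"
    using leading_coeff_const[OF k] unfolding E_def F_def by blast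
  \<comment> \<open>The factor of the discriminant common to all \<open>j\<close>: the discriminant
    is \<open>s j * s ((k + j) mod 4) * ?d\<close>.\<close>
  let ?d = "F * u\<^sup>2 + v * t"
  have "int (card {y. v + F * (inverse (s j) * y\<^sup>2) = inverse (s ((k + j) mod 4)) * (u + E * y)\<^sup>2})
      = 1 + eta (s j * s ((k + j) mod 4)) * eta ?d" if j: "j < 4" for j
  proof -
    define a b where "a = s j" and "b = s ((k + j) mod 4)"
    have nz: "a \<noteq> 0" "b \<noteq> 0" using s_nonzero j by (simp_all add: a_def b_def)
    have teq: "E\<^sup>2 * a - F * b = t" using lead[OF j] by (simp add: a_def b_def)
    have "v + F * (inverse a * y\<^sup>2) = inverse b * (u + E * y)\<^sup>2
        \<longleftrightarrow> t * y\<^sup>2 + 2 * (E * u * a) * y + (a * u\<^sup>2 - v * a * b) = 0" for y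
    proof -
      have "v + F * (inverse a * y\<^sup>2) = inverse b * (u + E * y)\<^sup>2
        \<longleftrightarrow> a * (u + E * y)\<^sup>2 = v * a * b + F * b * y\<^sup>2"
        using nz by (auto simp: field_simps)
      also have "\<dots> \<longleftrightarrow> a * (u + E * y)\<^sup>2 - (v * a * b + F * b * y\<^sup>2) = 0" by simp
      also have "a * (u + E * y)\<^sup>2 - (v * a * b + F * b * y\<^sup>2)
        = t * y\<^sup>2 + 2 * (E * u * a) * y + (a * u\<^sup>2 - v * a * b)"
        unfolding teq[symmetric] by (simp add: power2_eq_square algebra_simps)
      finally show ?thesis .
    qed
    then have "int (card {y. v + F * (inverse a * y\<^sup>2) = inverse b * (u + E * y)\<^sup>2})
        = 1 + eta ((E * u * a)\<^sup>2 - t * (a * u\<^sup>2 - v * a * b))"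
      by (simp add: quadratic_solution_count[OF two t])
    also have "(E * u * a)\<^sup>2 - t * (a * u\<^sup>2 - v * a * b) = (a * b) * ?d"
      unfolding teq[symmetric] by (simp add: power2_eq_square algebra_simps)
    finally show ?thesis by (simp add: quadratic_character_mult[OF two] a_def b_def)
  qed
  then have "int (\<Sum>j<4. card {y. v + F * (inverse (s j) * y\<^sup>2)
                               = inverse (s ((k + j) mod 4)) * (u + E * y)\<^sup>2})
      = (\<Sum>j<4. 1 + eta (s j * s ((k + j) mod 4)) * eta ?d)"
    by simp
  also have "\<dots> = 4" by (simp add: sum.distrib sum_eta_s[OF k] flip: sum_distrib_right)
  finally show ?thesis unfolding card_translate[OF k(2)] E_def F_def by linarith
qed

text \<open>The parabola index is unchanged, so the terms in \<open>y^2\<close> cancel and a linear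
  equation with slope \<open>2 * u\<close> is left: one root for each \<open>j\<close>.\<close>

lemma count_in_H:
  assumes u: "u \<noteq> 0"
  shows "card {r \<in> setR e f s2. ((u, v), 0) \<otimes>\<^bsub>semidirect e f\<^esub> r \<in> setR e f s2} = 4"
proof -
  have "card {y. v + inverse (s j) * y\<^sup>2 = inverse (s j) * (u + y)\<^sup>2} = 1" if j: "j < 4" for j
  proof -
    have "v + inverse (s j) * y\<^sup>2 = inverse (s j) * (u + y)\<^sup>2 \<longleftrightarrow> y = (s j * v - u\<^sup>2) / (2 * u)" for y
    proof -
      have "v + inverse (s j) * y\<^sup>2 = inverse (s j) * (u + y)\<^sup>2 \<longleftrightarrow> s j * v + y\<^sup>2 = (u + y)\<^sup>2"
        using s_nonzero[OF j] by (auto simp: field_simps)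
      also have "\<dots> \<longleftrightarrow> s j * v - u\<^sup>2 = 2 * u * y"
        by (auto simp: power2_eq_square algebra_simps)
      finally show ?thesis using u two by (auto simp: field_simps)
    qed
    then show ?thesis by simp
  qed
  then show ?thesis by (simp add: card_translate)
qed

text \<open>Such a translation keeps both the index and the first coordinate, and these determine a
  point of R.\<close>

lemma count_in_N:
  assumes v: "v \<noteq> 0"
  shows "{r \<in> setR e f s2. ((0, v), 0) \<otimes>\<^bsub>semidirect e f\<^esub> r \<in> setR e f s2} = {}"
  using v unfolding setR_eq by (auto simp: semidirect_def)

lemma relative_difference_set_setR:
  "relative_difference_set (semidirect e f) subN (4 * CARD('a)) CARD('a) (4 * CARD('a)) 4
     (setR e f s2)"
proof -
  let ?G = "semidirect e f" and ?R = "setR e f s2"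
  interpret G: group ?G by (rule semidirect_group[OF e4 f2])
  have N: "subN = {((0, v), 0) | v :: 'a. True}" by (auto simp: subN_def embH_def)
  have R: "?R \<subseteq> carrier ?G" unfolding setR_eq by (auto simp: semidirect_def)
  have inv: "inv\<^bsub>?G\<^esub> ((0, v), 0) = ((0, - v), 0)" for v
    by (rule G.inv_equality) (simp_all add: semidirect_def)
  have sub: "subgroup subN ?G"
    by (rule G.subgroupI) (auto simp: N inv, auto simp: semidirect_def)
  have "subN = (\<lambda>v::'a. ((0, v), 0)) ` UNIV" by (auto simp: N)
  then have cardN: "card (subN :: (('a \<times> 'a) \<times> nat) set) = CARD('a)"
    by (metis (no_types, lifting) Pair_inject card_image inj_onI)
  have count: "card {(r1, r2). r1 \<in> ?R \<and> r2 \<in> ?R \<and> g = r1 \<otimes>\<^bsub>?G\<^esub> inv\<^bsub>?G\<^esub> r2} = 4"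
    if "g \<in> carrier ?G - subN" for g
  proof -
    obtain u v k where g: "g = ((u, v), k)" "k < 4"
      using \<open>g \<in> carrier ?G - subN\<close> by (cases g) (auto simp: semidirect_def)
    have "card {r \<in> ?R. g \<otimes>\<^bsub>?G\<^esub> r \<in> ?R} = 4"
    proof (cases "k = 0")
      case True
      then have "u \<noteq> 0" using that g by (auto simp: N)
      then show ?thesis using True g count_in_H by simp
    qed (use g count_outside_H in simp)
    then show ?thesis using that card_difference_pairs[OF G.group_axioms R] by simp
  qed
  have none: "\<not> (\<exists>r1\<in>?R. \<exists>r2\<in>?R. g = r1 \<otimes>\<^bsub>?G\<^esub> inv\<^bsub>?G\<^esub> r2)" if g: "g \<in> subN - {\<one>\<^bsub>?G\<^esub>}" for g
  proof
    assume "\<exists>r1\<in>?R. \<exists>r2\<in>?R. g = r1 \<otimes>\<^bsub>?G\<^esub> inv\<^bsub>?G\<^esub> r2"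
    then obtain r1 r2 where r: "r1 \<in> ?R" "r2 \<in> ?R" "g = r1 \<otimes>\<^bsub>?G\<^esub> inv\<^bsub>?G\<^esub> r2" by blast
    have "r1 \<in> carrier ?G" "r2 \<in> carrier ?G" using r R by auto
    then have "g \<otimes>\<^bsub>?G\<^esub> r2 = r1" using r(3) by (simp add: G.m_assoc)
    then have "r2 \<in> {r \<in> ?R. g \<otimes>\<^bsub>?G\<^esub> r \<in> ?R}" using r(1,2) by simp
    moreover obtain v where "g = ((0, v), 0)" "v \<noteq> 0" using g by (auto simp: N semidirect_def)
    ultimately show False using count_in_N[of v] by simp
  qed
  have "finite (carrier ?G)" by (simp add: semidirect_def)
  moreover have "order ?G = 4 * CARD('a) * CARD('a)"
    by (simp add: semidirect_order power2_eq_square)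
  ultimately show ?thesis
    unfolding relative_difference_set_def
    using G.group_axioms sub cardN R card_setR count none by (intro conjI ballI)
qed

end

theorem theorem2p2:
  fixes e f :: "'a::{field,finite}" and q :: nat
  assumes "primepow q" and "CARD('a) = q" and "[q = 1] (mod 4)" and "q > 9"
    and "e ^ 4 = 1" and "f\<^sup>2 = - 1"
  shows "(\<exists>s2. s2 \<noteq> 0 \<and> quadratic_character (s1 e f s2 * s2 * s3 e f s2) = - 1) \<and>
         (\<forall>s2. s2 \<noteq> 0 \<longrightarrow> quadratic_character (s1 e f s2 * s2 * s3 e f s2) = - 1 \<longrightarrow>
            relative_difference_set (semidirect e f) subN (4 * q) q (4 * q) 4 (setR e f s2))"
proof -
  have two: "(2::'a) \<noteq> 0" using assms two_neq_zero_of_card[where 'a = 'a] by simp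
  have "rds_parameters e f s2" if "quadratic_character (s1 e f s2 * s2 * s3 e f s2) = - 1" for s2
    using that two assms by unfold_locales
  then show ?thesis
    using exists_s2[OF two _ assms(5,6)] rds_parameters.relative_difference_set_setR assms(2,4)
    by blast
qed

end
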